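(* Let $A\in\mathbb{R}^{m\times n}$ with $2\le m<n$ be a matrix whose columns have unit $\ell_2$-norm. Then $$\mathrm{Spark}(A)\ \ge\ \min_{1\le q\le n}\left\{q:\ \mu_1(q-1)\cdot\mu_1^{(2)}(q-1)\ge1\right\}.$$
   Context: Let $G=A^TA$ be the Gram matrix of $A$ and let $\widehat{G}=(\widehat{G}_{kj})$ be the $n\times n$ matrix obtained by sorting each row of $(|G_{kj}|)$ in descending order, with the diagonal entry $1$ placed first. For $0\le q\le n-1$, the Babel function is $\mu_1(q)=\max_{1\le k\le n}\sum_{j=2}^{q+1}\widehat{G}_{kj}$ (so $\mu_1(0)=0$); let $k_0=k_0(q)$ be an index attaining this maximum. The sub-Babel function is $\mu_1^{(2)}(q)=\max_{1\le k\le n,\ k\ne k_0}\sum_{j=2}^{q+1}\widehat{G}_{kj}$ (independent of the choice of $k_0$). $\mathrm{Spark}(A)$ is the smallest number of columns of $A$ that are linearly dependent. *)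

theory Defs
  imports "HOL-Analysis.Analysis" "HOL-Library.Multiset"
begin

definition gram :: "real ^ 'n ^ 'm \<Rightarrow> real ^ 'n ^ 'n" where
  "gram A = transpose A ** A"

text \<open>Row \<open>k\<close> of the sorted matrix: the diagonal entry, followed by the absolute values of the
  off-diagonal entries in descending order, with multiplicity.\<close>

definition sorted_gram_row :: "real ^ 'n ^ 'm \<Rightarrow> 'n \<Rightarrow> real list" where
  "sorted_gram_row A k =
     \<bar>gram A $ k $ k\<bar> #
     rev (sorted_list_of_multiset (image_mset (\<lambda>j. \<bar>gram A $ k $ j\<bar>) (mset_set (UNIV - {k}))))"

text \<open>Column positions are counted from 1, while list positions are counted from 0.\<close>

definition sorted_gram :: "real ^ 'n ^ 'm \<Rightarrow> 'n \<Rightarrow> nat \<Rightarrow> real" where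
  "sorted_gram A k j = sorted_gram_row A k ! (j - 1)"

text \<open>The sums below are meaningful for \<open>q \<le> CARD('n) - 1\<close>; for larger \<open>q\<close> they index past
  the end of the row.\<close>

definition babel_row_sum :: "real ^ 'n ^ 'm \<Rightarrow> nat \<Rightarrow> 'n \<Rightarrow> real" where
  "babel_row_sum A q k = (\<Sum>j = 2..q + 1. sorted_gram A k j)"

definition babel :: "real ^ 'n ^ 'm \<Rightarrow> nat \<Rightarrow> real" where
  "babel A q = Max (range (babel_row_sum A q))"

text \<open>An index attaining the maximum. If there are several, every choice leads to the same value
  of \<open>sub_babel\<close>, which is then equal to \<open>babel\<close>.\<close>

definition babel_index :: "real ^ 'n ^ 'm \<Rightarrow> nat \<Rightarrow> 'n" where
  "babel_index A q = arg_max_on (babel_row_sum A q) UNIV"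

text \<open>The maximum is over a nonempty set only if \<open>CARD('n) \<ge> 2\<close>.\<close>

definition sub_babel :: "real ^ 'n ^ 'm \<Rightarrow> nat \<Rightarrow> real" where
  "sub_babel A q = Max (babel_row_sum A q ` (UNIV - {babel_index A q}))"

text \<open>Dependence of the columns as an indexed family, not as a set of vectors: two equal columns
  with different indices are linearly dependent.\<close>

definition dependent_columns :: "real ^ 'n ^ 'm \<Rightarrow> 'n set \<Rightarrow> bool" where
  "dependent_columns A S \<longleftrightarrow>
     (\<exists>c. (\<exists>j\<in>S. c j \<noteq> 0) \<and> (\<Sum>j\<in>S. c j *\<^sub>R column j A) = 0)"

text \<open>Unspecified if all the columns together are linearly independent, which cannot happen
  when \<open>CARD('m) < CARD('n)\<close>.\<close>

definition spark :: "real ^ 'n ^ 'm \<Rightarrow> nat" where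
  "spark A = (LEAST p. \<exists>S. card S = p \<and> dependent_columns A S)"

end

theory Submission imports Defs
begin

text \<open>
  A linear dependence \<open>\<Sum>\<^sub>j\<^sub>\<in>\<^sub>S c\<^sub>j a\<^sub>j = 0\<close> among unit columns says that \<open>c\<close> is annihilated by the
  Gram matrix restricted to \<open>S\<close>. The bound is Brauer's argument for ovals of Cassini (the
  refinement of the Gershgorin circle argument that uses two rows instead of one) applied to the
  eigenvalue \<open>0\<close> of this matrix. Let \<open>k\<close> and \<open>l\<close> be the positions of the largest and the second
  largest \<open>\<bar>c\<^sub>j\<bar>\<close> in \<open>S\<close>, and let \<open>R\<^sub>k\<close>, \<open>R\<^sub>l\<close> be the sums of the absolute values of the
  off-diagonal entries of rows \<open>k\<close> and \<open>l\<close>. Taking inner products of the dependence with \<open>a\<^sub>k\<close>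
  and \<open>a\<^sub>l\<close> gives
  \<open>\<bar>c\<^sub>k\<bar> \<le> R\<^sub>k \<bar>c\<^sub>l\<bar>\<close> and \<open>\<bar>c\<^sub>l\<bar> \<le> R\<^sub>l \<bar>c\<^sub>k\<bar>\<close>. The first inequality forces \<open>c\<^sub>l \<noteq> 0\<close>, so multiplying
  the two yields \<open>R\<^sub>k R\<^sub>l \<ge> 1\<close> (lemma \<open>cassini_product_ge_1\<close>).

  Each \<open>R\<^sub>i\<close> adds up \<open>card S - 1\<close> off-diagonal entries of row \<open>i\<close>, hence is at most the sum of the
  \<open>card S - 1\<close> largest ones (lemma \<open>off_diagonal_sum_le_babel_row_sum\<close>). As \<open>k \<noteq> l\<close>, at least one
  of the two rows survives the removal of the row \<open>babel_index\<close>, so that one row sum is bounded by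
  the sub-Babel function while the other is bounded by the Babel function. Hence \<open>q = card S\<close>
  lies in the set whose minimum is taken. For a smallest dependent family \<open>S\<close>, which exists because
  there are more columns than rows, this is the claim.
\<close>

text \<open>Exchange argument: the head of a descending list dominates every element of \<open>M\<close>, so one
  element of \<open>M\<close> can be traded for the head, and the rest of \<open>M\<close> is still taken from the tail
  provided that the traded element is the head itself whenever the head occurs in \<open>M\<close>.\<close>

lemma sum_mset_le_sum_list_take:
  fixes xs :: "'a::{ordered_comm_monoid_add, linorder} list"
  assumes "sorted_wrt (\<ge>) xs" "M \<subseteq># mset xs"
  shows "sum_mset M \<le> sum_list (take (size M) xs)"
  using assms
proof (induction xs arbitrary: M)
  case Nil
  then show ?case by simp
next
  case (Cons y ys)
  show ?case
  proof (cases "M = {#}")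
    case True
    then show ?thesis by simp
  next
    case False
    obtain z where z: "z \<in># M" "y \<in># M \<longrightarrow> z = y"
      using False by (cases "y \<in># M") auto
    define N where "N = M - {#z#}"
    have M: "M = add_mset z N" using z(1) by (simp add: N_def)
    have "z \<le> y"
      using Cons.prems z(1) by (auto dest!: mset_subset_eqD)
    have "N \<subseteq># mset ys"
    proof (cases "z = y")
      case True
      then show ?thesis using Cons.prems(2) M by simp
    next
      case False
      then have "y \<notin># M" using z(2) by blast
      then have "M \<subseteq># mset ys"
        using Cons.prems(2) by (metis count_add_mset mset.simps(2) mset_subset_eqI
            mset_subset_eq_count not_in_iff le0)
      then show ?thesis using M by (metis mset_subset_eq_insertD subset_mset.less_imp_le)
    qed
    then have "sum_mset N \<le> sum_list (take (size N) ys)"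
      using Cons.IH Cons.prems(1) by simp
    then show ?thesis using \<open>z \<le> y\<close> M by (simp add: add_mono)
  qed
qed

abbreviation off_diagonal :: "real ^ 'n ^ 'm \<Rightarrow> 'n \<Rightarrow> real multiset" where
  "off_diagonal A k \<equiv> image_mset (\<lambda>j. \<bar>gram A $ k $ j\<bar>) (mset_set (UNIV - {k}))"

lemma babel_row_sum_eq_sum_list_take:
  fixes A :: "real ^ 'n ^ 'm"
  assumes "q < CARD('n)"
  shows "babel_row_sum A q k = sum_list (take q (rev (sorted_list_of_multiset (off_diagonal A k))))"
proof -
  define xs where "xs = rev (sorted_list_of_multiset (off_diagonal A k))"
  have len: "length xs = CARD('n) - 1"
    unfolding xs_def by (simp flip: size_mset)
  have "babel_row_sum A q k = (\<Sum>j = 2..q + 1. xs ! (j - 2))"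
    unfolding babel_row_sum_def sorted_gram_def sorted_gram_row_def xs_def[symmetric]
    by (rule sum.cong) (auto simp: nth_Cons' numeral_2_eq_2)
  also have "\<dots> = (\<Sum>i<q. xs ! i)"
    by (rule sum.reindex_bij_witness[of _ "\<lambda>i. i + 2" "\<lambda>j. j - 2"]) auto
  also have "\<dots> = sum_list (take q xs)"
    using assms len by (simp add: sum_list_sum_nth atLeast0LessThan)
  finally show ?thesis unfolding xs_def .
qed

lemma off_diagonal_sum_le_babel_row_sum:
  fixes A :: "real ^ 'n ^ 'm"
  assumes "k \<in> S"
  shows "(\<Sum>j\<in>S - {k}. \<bar>gram A $ k $ j\<bar>) \<le> babel_row_sum A (card S - 1) k"
proof -
  define M where "M = image_mset (\<lambda>j. \<bar>gram A $ k $ j\<bar>) (mset_set (S - {k}))"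
  define xs where "xs = rev (sorted_list_of_multiset (off_diagonal A k))"
  have "card S \<le> CARD('n)" "card S > 0"
    using assms by (auto intro: card_mono simp: card_gt_0_iff)
  then have lt: "card S - 1 < CARD('n)" by linarith
  have "M \<subseteq># mset xs"
    unfolding M_def xs_def by (auto intro!: image_mset_subseteq_mono subset_imp_msubset_mset_set)
  moreover have "sorted_wrt (\<ge>) xs"
    unfolding xs_def by (simp add: sorted_wrt_rev)
  ultimately have "sum_mset M \<le> sum_list (take (size M) xs)"
    by (rule sum_mset_le_sum_list_take[rotated])
  moreover have "size M = card S - 1"
    using assms by (simp add: M_def card_Diff_singleton)
  ultimately show ?thesis
    unfolding babel_row_sum_eq_sum_list_take[OF lt]
    by (simp add: M_def xs_def sum_unfold_sum_mset)
qed

text \<open>Brauer's two-row argument for a kernel vector of a matrix with unit diagonal. That the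
  family \<open>S\<close> has a second element is part of the conclusion: with \<open>k\<close> alone, the row equation
  would read \<open>c\<^sub>k = 0\<close>.\<close>

lemma cassini_product_ge_1:
  fixes c :: "'a \<Rightarrow> real" and g :: "'a \<Rightarrow> 'a \<Rightarrow> real"
  assumes "finite S" and nz: "\<exists>j\<in>S. c j \<noteq> 0"
    and diag: "\<And>k. k \<in> S \<Longrightarrow> g k k = 1"
    and ker: "\<And>k. k \<in> S \<Longrightarrow> (\<Sum>j\<in>S. g k j * c j) = 0"
  shows "\<exists>k\<in>S. \<exists>l\<in>S. k \<noteq> l \<and> 1 \<le> (\<Sum>j\<in>S - {k}. \<bar>g k j\<bar>) * (\<Sum>j\<in>S - {l}. \<bar>g l j\<bar>)"
proof -
  define R where "R k = (\<Sum>j\<in>S - {k}. \<bar>g k j\<bar>)" for k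
  have R_nonneg: "R k \<ge> 0" for k by (simp add: R_def sum_nonneg)
  have row: "\<bar>c k\<bar> \<le> R k * b" if "k \<in> S" and b: "\<And>j. j \<in> S - {k} \<Longrightarrow> \<bar>c j\<bar> \<le> b" for k b
  proof -
    have "c k = - (\<Sum>j\<in>S - {k}. g k j * c j)"
      using ker[OF \<open>k \<in> S\<close>] diag[OF \<open>k \<in> S\<close>] sum.remove[OF \<open>finite S\<close> \<open>k \<in> S\<close>, of "\<lambda>j. g k j * c j"]
      by simp
    then have "\<bar>c k\<bar> \<le> (\<Sum>j\<in>S - {k}. \<bar>g k j * c j\<bar>)"
      by (simp add: sum_abs)
    also have "\<dots> \<le> (\<Sum>j\<in>S - {k}. \<bar>g k j\<bar> * b)"
      by (intro sum_mono) (simp add: abs_mult b mult_left_mono)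
    finally show ?thesis by (simp add: R_def sum_distrib_right)
  qed
  have ex_max: "\<exists>k\<in>T. \<forall>j\<in>T. \<bar>c j\<bar> \<le> \<bar>c k\<bar>" if "finite T" "T \<noteq> {}" for T
  proof -
    have "Max ((\<lambda>j. \<bar>c j\<bar>) ` T) \<in> (\<lambda>j. \<bar>c j\<bar>) ` T"
      using that by (intro Max_in) auto
    then obtain k where "k \<in> T" "\<bar>c k\<bar> = Max ((\<lambda>j. \<bar>c j\<bar>) ` T)" by auto
    then show ?thesis using that by (intro bexI[of _ k]) auto
  qed
  obtain k where k: "k \<in> S" and kmax: "\<And>j. j \<in> S \<Longrightarrow> \<bar>c j\<bar> \<le> \<bar>c k\<bar>"
    using ex_max[of S] \<open>finite S\<close> nz by blast
  have ck: "\<bar>c k\<bar> > 0" using nz kmax by force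
  have "S - {k} \<noteq> {}"
    using row[OF k, of 0] ck by fastforce
  then obtain l where l: "l \<in> S - {k}" and lmax: "\<And>j. j \<in> S - {k} \<Longrightarrow> \<bar>c j\<bar> \<le> \<bar>c l\<bar>"
    using ex_max[of "S - {k}"] \<open>finite S\<close> by blast
  have kl: "\<bar>c k\<bar> \<le> R k * \<bar>c l\<bar>" using row[OF k] lmax by blast
  have lk: "\<bar>c l\<bar> \<le> R l * \<bar>c k\<bar>" using row l kmax by blast
  have "\<bar>c k\<bar> \<le> R k * (R l * \<bar>c k\<bar>)"
    using kl mult_left_mono[OF lk R_nonneg[of k]] by linarith
  then have "1 \<le> R k * R l"
    using ck by (simp flip: mult.assoc)
  then have "k \<noteq> l \<and> 1 \<le> R k * R l" using l by auto
  then show ?thesis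
    using k l unfolding R_def by (intro bexI[of _ k] bexI[of _ l]) simp_all
qed

lemma gram_nth: "gram A $ k $ j = column k A \<bullet> column j A"
  by (simp add: gram_def matrix_matrix_mult_def transpose_def column_def inner_vec_def)

text \<open>Rows \<open>k\<close> and \<open>l\<close> are distinct, so at least one of them is not the row left out in
  \<open>sub_babel\<close>; that row pairs with \<open>sub_babel\<close> and the other one with \<open>babel\<close>.\<close>

lemma babel_row_sum_mult_le:
  fixes A :: "real ^ 'n ^ 'm"
  assumes "k \<noteq> l" and "\<And>i. i \<in> {k, l} \<Longrightarrow> babel_row_sum A q i \<ge> 0"
  shows "babel_row_sum A q k * babel_row_sum A q l \<le> babel A q * sub_babel A q"
proof -
  have babel: "babel_row_sum A q i \<le> babel A q" for i
    unfolding babel_def by (rule Max_ge) auto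
  have sub: "babel_row_sum A q i \<le> sub_babel A q" if "i \<noteq> babel_index A q" for i
    unfolding sub_babel_def using that by (intro Max_ge) auto
  show ?thesis
  proof (cases "l = babel_index A q")
    case True
    then have "babel_row_sum A q l * babel_row_sum A q k \<le> babel A q * sub_babel A q"
      using assms babel[of l] sub[of k] by (intro mult_mono) (auto intro: order_trans)
    then show ?thesis by (simp add: mult.commute)
  next
    case False
    then show ?thesis
      using assms babel[of k] sub[of l] by (intro mult_mono) (auto intro: order_trans)
  qed
qed

lemma dependent_columns_imp_babel_product_ge_1:
  fixes A :: "real ^ 'n ^ 'm"
  assumes unit: "\<forall>j. norm (column j A) = 1" and "dependent_columns A S"
  shows "babel A (card S - 1) * sub_babel A (card S - 1) \<ge> 1"
proof -
  obtain c where nz: "\<exists>j\<in>S. c j \<noteq> 0" and dep: "(\<Sum>j\<in>S. c j *\<^sub>R column j A) = 0"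
    using assms(2) unfolding dependent_columns_def by blast
  have diag: "gram A $ k $ k = 1" for k
    using unit by (simp add: gram_nth dot_square_norm)
  have ker: "(\<Sum>j\<in>S. gram A $ k $ j * c j) = 0" for k
  proof -
    have "column k A \<bullet> (\<Sum>j\<in>S. c j *\<^sub>R column j A) = 0"
      by (simp add: dep)
    then show ?thesis by (simp add: inner_sum_right gram_nth mult.commute)
  qed
  obtain k l where kl: "k \<in> S" "l \<in> S" "k \<noteq> l" and
    prod: "1 \<le> (\<Sum>j\<in>S - {k}. \<bar>gram A $ k $ j\<bar>) * (\<Sum>j\<in>S - {l}. \<bar>gram A $ l $ j\<bar>)"
    using cassini_product_ge_1[of S c "\<lambda>k j. gram A $ k $ j"] nz diag ker by auto
  have row: "0 \<le> (\<Sum>j\<in>S - {i}. \<bar>gram A $ i $ j\<bar>)"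
    "(\<Sum>j\<in>S - {i}. \<bar>gram A $ i $ j\<bar>) \<le> babel_row_sum A (card S - 1) i" if "i \<in> S" for i
    using off_diagonal_sum_le_babel_row_sum[OF that] by (auto simp: sum_nonneg)
  have nonneg: "0 \<le> babel_row_sum A (card S - 1) i" if "i \<in> S" for i
    using row[OF that] by linarith
  note prod
  also have "(\<Sum>j\<in>S - {k}. \<bar>gram A $ k $ j\<bar>) * (\<Sum>j\<in>S - {l}. \<bar>gram A $ l $ j\<bar>)
      \<le> babel_row_sum A (card S - 1) k * babel_row_sum A (card S - 1) l"
    using row nonneg kl by (intro mult_mono) auto
  also have "\<dots> \<le> babel A (card S - 1) * sub_babel A (card S - 1)"
    using nonneg kl by (intro babel_row_sum_mult_le) auto
  finally show ?thesis .
qed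

lemma dependent_columns_UNIV:
  fixes A :: "real ^ 'n ^ 'm"
  assumes "CARD('m) < CARD('n)"
  shows "dependent_columns A UNIV"
proof -
  have "rank A \<noteq> CARD('n)" using rank_bound[of A] assms by simp
  then obtain x where "x \<noteq> 0" "A *v x = 0"
    using matrix_nonfull_linear_equations_eq by blast
  moreover have "\<exists>j. x $ j \<noteq> 0"
    using \<open>x \<noteq> 0\<close> by (simp add: vec_eq_iff)
  ultimately show ?thesis
    unfolding dependent_columns_def
    by (intro exI[of _ "($) x"]) (simp add: matrix_mult_sum scalar_mult_eq_scaleR)
qed

theorem theorem3p1:
  fixes A :: "real ^ 'n ^ 'm"
  assumes "2 \<le> CARD('m)" and "CARD('m) < CARD('n)"
    and "\<forall>j. norm (column j A) = 1"
  shows "spark A \<ge> Min {q \<in> {1..CARD('n)}. babel A (q - 1) * sub_babel A (q - 1) \<ge> 1}"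
proof -
  have "\<exists>S. card S = spark A \<and> dependent_columns A S"
    unfolding spark_def
    using LeastI[of "\<lambda>p. \<exists>S. card S = p \<and> dependent_columns A S", OF exI[of _ UNIV]]
      dependent_columns_UNIV[OF assms(2)] by blast
  then obtain S where S: "card S = spark A" "dependent_columns A S" by blast
  have "S \<noteq> {}" using S(2) by (auto simp: dependent_columns_def)
  then have "card S \<in> {1..CARD('n)}"
    by (auto simp: card_gt_0_iff Suc_le_eq intro: card_mono)
  then show ?thesis
    using dependent_columns_imp_babel_product_ge_1[OF assms(3) S(2)] S(1)
    by (intro Min_le) auto
qed

end
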